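(* Consider a nonlinear Markov decision problem with a state-partitioned tabular policy parameterized by the softmax parameter vector $\boldsymbol\gamma$, with notation as in the context. Then for every time $0\le t<T$, expert $z\in\mathcal Z$ and action $a\in\mathcal A$, the corresponding component of the approximate natural gradient $\widetilde\nabla_{\boldsymbol\gamma}J_{\boldsymbol\gamma}$ is $$\widetilde\nabla_{\gamma^{(t)}_{z,a}}J_{\boldsymbol\gamma}=\overline Q^{(t)}_{z,\boldsymbol\gamma}(a)-\frac1{|\mathcal A|}\sum_{\tilde a\in\mathcal A}\overline Q^{(t)}_{z,\boldsymbol\gamma}(\tilde a).$$
   Context: Smooth extension property: a function on a convex subset of Euclidean space has the smooth extension property if it admits an extension to a neighborhood of the relative interior of its domain that is continuously differentiable, with the gradient extending by continuity to all boundary points in the original domain. Gradients and partial derivatives are taken in ordinary coordinates using such extensions. Nonlinear Markov decision problem: horizon $T$; finite state space $\mathcal S$ and action space $\mathcal A$; transition pmfs $p^{(t)}_\mu(\cdot|s,a)$ on $\mathcal S$ ($0\le t<T$), immediate rewards $r^{(t)}_\mu(s,a)$ ($0\le t<T$) and terminal reward $r^{(T)}_\mu(s)$, all parameterized by a pmf $\mu$ on $\mathcal S$ and such that their restrictions to $\{\mu:\mu(s)>0\}$ have the smooth extension property in $\mu$; and an initial pmf $\mu^{(0)}$ on $\mathcal S$. State-partitioned tabular policy in softmax coordinates: $\mathcal S$ is partitioned into disjoint subsets $\mathcal S_z$, $z\in\mathcal Z$ ($\mathcal Z$ finite; experts), and $z(s)$ is the $z$ with $s\in\mathcal S_z$.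 The parameter is $\boldsymbol\gamma=(\gamma^{(t)}_z)_{0\le t<T,z\in\mathcal Z}$ with $\gamma^{(t)}_z=(\gamma^{(t)}_{z,a})_{a\in\mathcal A}\in\mathbb R^{|\mathcal A|}$ and $\sum_a\gamma^{(t)}_{z,a}=0$. With $\hat\pi_\psi(a)=\exp(\psi_a)/\sum_{\tilde a}\exp(\psi_{\tilde a})$ for $\psi\in\mathbb R^{|\mathcal A|}$, the policy is $\pi^{(t)}_{\gamma^{(t)}}(a|s)=\hat\pi_{\gamma^{(t)}_{z(s)}}(a)$. Gradients in $\boldsymbol\gamma$ are taken in ambient coordinates (each $\gamma^{(t)}_z$ ranging in $\mathbb R^{|\mathcal A|}$, via the softmax formula). Forward recursion: $\mu^{(0)}_{\boldsymbol\gamma}=\mu^{(0)}$, $\mu^{(t+1)}_{\boldsymbol\gamma}(s')=\sum_{s,a}\mu^{(t)}_{\boldsymbol\gamma}(s)\hat\pi_{\gamma^{(t)}_{z(s)}}(a)p^{(t)}_{\mu^{(t)}_{\boldsymbol\gamma}}(s'|s,a)$. Objective: $$J_{\boldsymbol\gamma}=\sum_{t=0}^{T-1}\sum_{s,a}\mu^{(t)}_{\boldsymbol\gamma}(s)\hat\pi_{\gamma^{(t)}_{z(s)}}(a)r^{(t)}_{\mu^{(t)}_{\boldsymbol\gamma}}(s,a)+\sum_s\mu^{(T)}_{\boldsymbol\gamma}(s)r^{(T)}_{\mu^{(T)}_{\boldsymbol\gamma}}(s).$$ With $Q^{(t)}_{\mu,\sigma'}(s,a)=r^{(t)}_\mu(s,a)+\sum_{s'}p^{(t)}_\mu(s'|s,a)\sigma'(s')$,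 the backward recursion is $$\sigma^{(T)}_{\boldsymbol\gamma}(s)=r^{(T)}_{\mu^{(T)}_{\boldsymbol\gamma}}(s)+\sum_{\tilde s}\mu^{(T)}_{\boldsymbol\gamma}(\tilde s)\tfrac{\partial}{\partial\mu(s)}r^{(T)}_{\mu^{(T)}_{\boldsymbol\gamma}}(\tilde s),$$ $$\sigma^{(t)}_{\boldsymbol\gamma}(s)=\sum_a\hat\pi_{\gamma^{(t)}_{z(s)}}(a)Q^{(t)}_{\mu^{(t)}_{\boldsymbol\gamma},\sigma^{(t+1)}_{\boldsymbol\gamma}}(s,a)+\sum_{\tilde s,a}\mu^{(t)}_{\boldsymbol\gamma}(\tilde s)\hat\pi_{\gamma^{(t)}_{z(\tilde s)}}(a)\tfrac{\partial}{\partial\mu(s)}Q^{(t)}_{\mu^{(t)}_{\boldsymbol\gamma},\sigma^{(t+1)}_{\boldsymbol\gamma}}(\tilde s,a),$$ where partial derivatives in $\mu$ are taken with $\sigma'$ held constant and evaluated at the indicated subscripts. With $\mu(\mathcal S_z)=\sum_{s\in\mathcal S_z}\mu(s)$, $$\overline Q^{(t)}_{z,\boldsymbol\gamma}(a)=\sum_{s\in\mathcal S_z}\frac{\mu^{(t)}_{\boldsymbol\gamma}(s)}{\mu^{(t)}_{\boldsymbol\gamma}(\mathcal S_z)}Q^{(t)}_{\mu^{(t)}_{\boldsymbol\gamma},\sigma^{(t+1)}_{\boldsymbol\gamma}}(s,a)\ \text{ if }\mu^{(t)}_{\boldsymbol\gamma}(\mathcal S_z)>0,\qquad \overline Q^{(t)}_{z,\boldsymbol\gamma}(a)=0\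 \text{ otherwise.}$$ Approximate natural gradient: $\widetilde\nabla_{\boldsymbol\gamma}J_{\boldsymbol\gamma}=\tilde F(\boldsymbol\gamma)^\dagger\,\nabla_{\boldsymbol\gamma}J_{\boldsymbol\gamma}$, where $\dagger$ is the Moore-Penrose inverse and $\tilde F(\boldsymbol\gamma)$ is the block diagonal matrix whose diagonal block for the pair $(t,z)$ is $\mu^{(t)}_{\boldsymbol\gamma}(\mathcal S_z)\,\hat F(\gamma^{(t)}_z)$ with $$\hat F(\psi)=\sum_a\hat\pi_\psi(a)\,(\nabla_\psi\log\hat\pi_\psi(a))(\nabla_\psi\log\hat\pi_\psi(a))^\top .$$ $\widetilde\nabla_{\gamma^{(t)}_{z,a}}J_{\boldsymbol\gamma}$ denotes the component of $\widetilde\nabla_{\boldsymbol\gamma}J_{\boldsymbol\gamma}$ indexed by $(t,z,a)$.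
   Formalization: Added: as parameters approach γ, each state's reward stays bounded wherever that state's probability is positive (the claim can fail if a probability vanishes only at γ and rewards blow up). Smooth extensions are taken to be continuous at boundary points of the domain. *)

theory Defs
  imports "HOL-Analysis.Analysis"
begin

section \<open>Smooth extension property\<close>

text \<open>
  \<open>F\<close> extends \<open>f\<close> from \<open>D\<close> to the union of \<open>D\<close> with an open neighbourhood \<open>U\<close> of the relative
  interior of \<open>D\<close>.  On \<open>U\<close> it is continuously differentiable with gradient \<open>G\<close> (in the coordinates
  of the ambient space), and \<open>G\<close> extends continuously to the points of \<open>D\<close> outside \<open>U\<close>.  Such a
  \<open>G\<close> is in general not unique: its component normal to the affine hull of \<open>D\<close> depends on \<open>F\<close>.
\<close>

definition smooth_extension_gradient ::
    "('v::euclidean_space \<Rightarrow> real) \<Rightarrow> 'v set \<Rightarrow> ('v \<Rightarrow> 'v) \<Rightarrow> bool" where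
  "smooth_extension_gradient f D G \<longleftrightarrow>
     (\<exists>U F. open U \<and> rel_interior D \<subseteq> U \<and>
        (\<forall>x\<in>D. F x = f x) \<and> continuous_on (U \<union> D) F \<and>
        (\<forall>x\<in>U. GDERIV F x :> G x) \<and> continuous_on (U \<union> D) G)"

definition smooth_extension_property :: "('v::euclidean_space \<Rightarrow> real) \<Rightarrow> 'v set \<Rightarrow> bool" where
  "smooth_extension_property f D \<longleftrightarrow> (\<exists>G. smooth_extension_gradient f D G)"

section \<open>Nonlinear Markov decision problems\<close>

text \<open>Pmfs on a finite type, as coordinate vectors, so that derivatives with respect to them make
  sense.\<close>

definition pmfs :: "(real ^ 's::finite) set" where
  "pmfs = {\<mu>. (\<forall>s. 0 \<le> \<mu> $ s) \<and> (\<Sum>s\<in>UNIV. \<mu> $ s) = 1}"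

text \<open>\<open>trans M t \<mu> s a $ s'\<close> is the probability of moving from \<open>s\<close> to \<open>s'\<close> under action \<open>a\<close>.\<close>

record ('s::finite, 'a::finite) mdp =
  horizon :: nat
  trans :: "nat \<Rightarrow> real ^ 's \<Rightarrow> 's \<Rightarrow> 'a \<Rightarrow> real ^ 's"
  reward :: "nat \<Rightarrow> real ^ 's \<Rightarrow> 's \<Rightarrow> 'a \<Rightarrow> real"
  final_reward :: "real ^ 's \<Rightarrow> 's \<Rightarrow> real"
  init :: "real ^ 's"

definition nonlinear_mdp :: "('s::finite, 'a::finite) mdp \<Rightarrow> bool" where
  "nonlinear_mdp M \<longleftrightarrow>
     init M \<in> pmfs \<and>
     (\<forall>t<horizon M. \<forall>\<mu>\<in>pmfs. \<forall>s a. trans M t \<mu> s a \<in> pmfs) \<and>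
     (\<forall>t<horizon M. \<forall>s a s'.
        smooth_extension_property (\<lambda>\<mu>. trans M t \<mu> s a $ s') {\<mu>\<in>pmfs. 0 < \<mu> $ s}) \<and>
     (\<forall>t<horizon M. \<forall>s a.
        smooth_extension_property (\<lambda>\<mu>. reward M t \<mu> s a) {\<mu>\<in>pmfs. 0 < \<mu> $ s}) \<and>
     (\<forall>s. smooth_extension_property (\<lambda>\<mu>. final_reward M \<mu> s) {\<mu>\<in>pmfs. 0 < \<mu> $ s})"

text \<open>
  A choice of gradients in \<open>\<mu>\<close>, taken from smooth extensions.  \<open>d_trans D t \<mu> s a s'\<close> is the
  gradient of the \<open>s'\<close>-component of \<open>trans M t \<mu> s a\<close>.  Nothing is required where \<open>\<mu> $ s = 0\<close>.
\<close>

record ('s::finite, 'a::finite) mdp_gradients =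
  d_trans :: "nat \<Rightarrow> real ^ 's \<Rightarrow> 's \<Rightarrow> 'a \<Rightarrow> 's \<Rightarrow> real ^ 's"
  d_reward :: "nat \<Rightarrow> real ^ 's \<Rightarrow> 's \<Rightarrow> 'a \<Rightarrow> real ^ 's"
  d_final_reward :: "real ^ 's \<Rightarrow> 's \<Rightarrow> real ^ 's"

definition extension_gradients ::
    "('s::finite, 'a::finite) mdp \<Rightarrow> ('s, 'a) mdp_gradients \<Rightarrow> bool" where
  "extension_gradients M D \<longleftrightarrow>
     (\<forall>t<horizon M. \<forall>s a s'.
        smooth_extension_gradient (\<lambda>\<mu>. trans M t \<mu> s a $ s') {\<mu>\<in>pmfs. 0 < \<mu> $ s}
          (\<lambda>\<mu>. d_trans D t \<mu> s a s')) \<and>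
     (\<forall>t<horizon M. \<forall>s a.
        smooth_extension_gradient (\<lambda>\<mu>. reward M t \<mu> s a) {\<mu>\<in>pmfs. 0 < \<mu> $ s}
          (\<lambda>\<mu>. d_reward D t \<mu> s a)) \<and>
     (\<forall>s. smooth_extension_gradient (\<lambda>\<mu>. final_reward M \<mu> s) {\<mu>\<in>pmfs. 0 < \<mu> $ s}
          (\<lambda>\<mu>. d_final_reward D \<mu> s))"

section \<open>State-partitioned softmax policies\<close>

text \<open>
  The partition of the state space is given by \<open>e :: 's \<Rightarrow> 'z\<close>, mapping a state to its expert.
  In this section and the next one the policy parameter is \<open>g :: nat \<Rightarrow> 'z \<Rightarrow> real ^ 'a\<close>, where
  \<open>g t z\<close> is the block of expert \<open>z\<close> at time \<open>t\<close>.
\<close>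

definition softmax :: "real ^ 'a \<Rightarrow> real ^ 'a::finite" where
  "softmax \<psi> = (\<chi> a. exp (\<psi> $ a) / (\<Sum>b\<in>UNIV. exp (\<psi> $ b)))"

definition policy :: "('s \<Rightarrow> 'z) \<Rightarrow> (nat \<Rightarrow> 'z \<Rightarrow> real ^ 'a) \<Rightarrow> nat \<Rightarrow> 's \<Rightarrow> 'a::finite \<Rightarrow> real" where
  "policy e g t s a = softmax (g t (e s)) $ a"

definition cell :: "('s \<Rightarrow> 'z) \<Rightarrow> 'z \<Rightarrow> 's set" where
  "cell e z = {s. e s = z}"

section \<open>Forward and backward recursions\<close>

primrec state_pmf ::
    "('s::finite, 'a::finite) mdp \<Rightarrow> ('s \<Rightarrow> 'z) \<Rightarrow> (nat \<Rightarrow> 'z \<Rightarrow> real ^ 'a) \<Rightarrow> nat \<Rightarrow> real ^ 's" where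
  "state_pmf M e g 0 = init M"
| "state_pmf M e g (Suc t) =
     (\<chi> s'. \<Sum>s\<in>UNIV. \<Sum>a\<in>UNIV.
        state_pmf M e g t $ s * policy e g t s a * trans M t (state_pmf M e g t) s a $ s')"

definition objective ::
    "('s::finite, 'a::finite) mdp \<Rightarrow> ('s \<Rightarrow> 'z) \<Rightarrow> (nat \<Rightarrow> 'z \<Rightarrow> real ^ 'a) \<Rightarrow> real" where
  "objective M e g =
     (\<Sum>t<horizon M. \<Sum>s\<in>UNIV. \<Sum>a\<in>UNIV.
        state_pmf M e g t $ s * policy e g t s a * reward M t (state_pmf M e g t) s a) +
     (\<Sum>s\<in>UNIV. state_pmf M e g (horizon M) $ s *
        final_reward M (state_pmf M e g (horizon M)) s)"

definition Q_fun ::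
    "('s::finite, 'a::finite) mdp \<Rightarrow> nat \<Rightarrow> real ^ 's \<Rightarrow> real ^ 's \<Rightarrow> 's \<Rightarrow> 'a \<Rightarrow> real" where
  "Q_fun M t \<mu> \<sigma> s a = reward M t \<mu> s a + (\<Sum>s'\<in>UNIV. trans M t \<mu> s a $ s' * \<sigma> $ s')"

text \<open>The gradient of \<open>Q_fun M t \<mu> \<sigma> s a\<close> in \<open>\<mu>\<close>, with \<open>\<sigma>\<close> held constant.\<close>

definition d_Q_fun ::
    "('s::finite, 'a::finite) mdp_gradients \<Rightarrow> nat \<Rightarrow> real ^ 's \<Rightarrow> real ^ 's \<Rightarrow> 's \<Rightarrow> 'a \<Rightarrow> real ^ 's" where
  "d_Q_fun D t \<mu> \<sigma> s a = d_reward D t \<mu> s a + (\<Sum>s'\<in>UNIV. \<sigma> $ s' *\<^sub>R d_trans D t \<mu> s a s')"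

text \<open>
  The backward recursion.  Derivatives at states \<open>s'\<close> of probability zero, where no smooth
  extension is available, only occur multiplied by that probability.  Values at times beyond the
  horizon are irrelevant.
\<close>

function costate ::
    "('s::finite, 'a::finite) mdp \<Rightarrow> ('s, 'a) mdp_gradients \<Rightarrow> ('s \<Rightarrow> 'z) \<Rightarrow>
     (nat \<Rightarrow> 'z \<Rightarrow> real ^ 'a) \<Rightarrow> nat \<Rightarrow> real ^ 's" where
  "costate M D e g t =
     (let \<mu> = state_pmf M e g t in
      if t < horizon M then
        let \<sigma>' = costate M D e g (Suc t) in
        (\<chi> s. (\<Sum>a\<in>UNIV. policy e g t s a * Q_fun M t \<mu> \<sigma>' s a) +
              (\<Sum>s'\<in>UNIV. \<Sum>a\<in>UNIV. \<mu> $ s' * policy e g t s' a * d_Q_fun D t \<mu> \<sigma>' s' a $ s))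
      else
        (\<chi> s. final_reward M \<mu> s + (\<Sum>s'\<in>UNIV. \<mu> $ s' * d_final_reward D \<mu> s' $ s)))"
  by auto
termination
  by (relation "Wellfounded.measure (\<lambda>(M, D, e, g, t). horizon M - t)") auto

declare costate.simps [simp del]

definition cell_mass ::
    "('s::finite, 'a::finite) mdp \<Rightarrow> ('s \<Rightarrow> 'z) \<Rightarrow> (nat \<Rightarrow> 'z \<Rightarrow> real ^ 'a) \<Rightarrow> nat \<Rightarrow> 'z \<Rightarrow> real" where
  "cell_mass M e g t z = (\<Sum>s\<in>cell e z. state_pmf M e g t $ s)"

definition Q_bar ::
    "('s::finite, 'a::finite) mdp \<Rightarrow> ('s, 'a) mdp_gradients \<Rightarrow> ('s \<Rightarrow> 'z) \<Rightarrow>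
     (nat \<Rightarrow> 'z \<Rightarrow> real ^ 'a) \<Rightarrow> nat \<Rightarrow> 'z \<Rightarrow> 'a \<Rightarrow> real" where
  "Q_bar M D e g t z a =
     (if 0 < cell_mass M e g t z then
        \<Sum>s\<in>cell e z. state_pmf M e g t $ s / cell_mass M e g t z *
          Q_fun M t (state_pmf M e g t) (costate M D e g (Suc t)) s a
      else 0)"

section \<open>Approximate natural gradient\<close>

definition gradient :: "('v::real_inner \<Rightarrow> real) \<Rightarrow> 'v \<Rightarrow> 'v" where
  "gradient f x = (THE G. GDERIV f x :> G)"

definition moore_penrose :: "real ^ 'n ^ 'm \<Rightarrow> real ^ 'm ^ 'n \<Rightarrow> bool" where
  "moore_penrose A X \<longleftrightarrow>
     A ** X ** A = A \<and> X ** A ** X = X \<and>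
     transpose (A ** X) = A ** X \<and> transpose (X ** A) = X ** A"

definition pinv :: "real ^ 'n ^ 'm \<Rightarrow> real ^ 'm ^ 'n" where
  "pinv A = (THE X. moore_penrose A X)"

definition softmax_fisher :: "real ^ 'a \<Rightarrow> real ^ 'a ^ 'a::finite" where
  "softmax_fisher \<psi> = (\<Sum>a\<in>UNIV. softmax \<psi> $ a *\<^sub>R
     (let v = gradient (\<lambda>\<phi>. ln (softmax \<phi> $ a)) \<psi> in \<chi> i j. v $ i * v $ j))"

text \<open>
  To differentiate in all policy parameters jointly they are collected in one Euclidean vector
  \<open>\<gamma> :: real ^ ('t \<times> 'z \<times> 'a)\<close>.  The finite type \<open>'t\<close> is a copy of the set \<open>{..<T}\<close> of times, via a
  bijection \<open>\<iota> :: nat \<Rightarrow> 't\<close> from \<open>{..<T}\<close> onto \<open>'t\<close>.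
\<close>

definition blocks :: "(nat \<Rightarrow> 't) \<Rightarrow> real ^ ('t::finite \<times> 'z::finite \<times> 'a::finite) \<Rightarrow>
    nat \<Rightarrow> 'z \<Rightarrow> real ^ 'a" where
  "blocks \<iota> \<gamma> t z = (\<chi> a. \<gamma> $ (\<iota> t, z, a))"

definition approx_fisher ::
    "('s::finite, 'a::finite) mdp \<Rightarrow> ('s \<Rightarrow> 'z::finite) \<Rightarrow> (nat \<Rightarrow> 't::finite) \<Rightarrow>
     real ^ ('t \<times> 'z \<times> 'a) \<Rightarrow> real ^ ('t \<times> 'z \<times> 'a) ^ ('t \<times> 'z \<times> 'a)" where
  "approx_fisher M e \<iota> \<gamma> = (\<chi> i j. case (i, j) of ((n, z, a), (n', z', a')) \<Rightarrow>
     if n = n' \<and> z = z' then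
       let t = inv_into {..<horizon M} \<iota> n in
       cell_mass M e (blocks \<iota> \<gamma>) t z * softmax_fisher (blocks \<iota> \<gamma> t z) $ a $ a'
     else 0)"

definition approx_natural_gradient ::
    "('s::finite, 'a::finite) mdp \<Rightarrow> ('s \<Rightarrow> 'z::finite) \<Rightarrow> (nat \<Rightarrow> 't::finite) \<Rightarrow>
     real ^ ('t \<times> 'z \<times> 'a) \<Rightarrow> real ^ ('t \<times> 'z \<times> 'a)" where
  "approx_natural_gradient M e \<iota> \<gamma> =
     pinv (approx_fisher M e \<iota> \<gamma>) *v gradient (\<lambda>\<gamma>'. objective M e (blocks \<iota> \<gamma>')) \<gamma>"

text \<open>
  Smoothness on \<open>{\<mu>\<in>pmfs. 0 < \<mu> $ s}\<close> does not prevent the rewards of \<open>s\<close> from blowing up as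
  \<open>\<mu> $ s\<close> tends to \<open>0\<close>.  If the probability of \<open>s\<close> vanishes at \<open>\<gamma>\<close> but not near \<open>\<gamma>\<close>, such rewards can
  make the objective discontinuous at \<open>\<gamma>\<close>, or differentiable with a gradient not captured by the
  backward recursion.  The following condition excludes this.  It holds for bounded rewards, and
  it holds at every \<open>\<gamma>\<close> around which the supports of the state pmfs are locally constant.
\<close>

definition rewards_bounded_near ::
    "('s::finite, 'a::finite) mdp \<Rightarrow> ('s \<Rightarrow> 'z::finite) \<Rightarrow> (nat \<Rightarrow> 't::finite) \<Rightarrow>
     real ^ ('t \<times> 'z \<times> 'a) \<Rightarrow> bool" where
  "rewards_bounded_near M e \<iota> \<gamma> \<longleftrightarrow>
     (\<forall>t<horizon M. \<forall>s a.
        Bfun (\<lambda>\<gamma>'. reward M t (state_pmf M e (blocks \<iota> \<gamma>') t) s a)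
          (at \<gamma> within {\<gamma>'. 0 < state_pmf M e (blocks \<iota> \<gamma>') t $ s})) \<and>
     (\<forall>s. Bfun (\<lambda>\<gamma>'. final_reward M (state_pmf M e (blocks \<iota> \<gamma>') (horizon M)) s)
          (at \<gamma> within {\<gamma>'. 0 < state_pmf M e (blocks \<iota> \<gamma>') (horizon M) $ s}))"

end

theory Submission
  imports Defs
begin

text \<open>
  The gradient of the objective lies in the range of the approximate Fisher matrix, and it is the
  image of the averaged state-action values:
  \<open>gradient J = approx_fisher *v Q_bar\<close>.  Applying the pseudoinverse
  therefore removes from \<open>Q_bar\<close> its orthogonal projection onto the kernel of the Fisher matrix.
  That kernel splits into blocks.  If an expert has positive mass, its block of the kernel consists of
  the constant vectors, since adding a constant to the parameters of a softmax does not change it, and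
  removing the projection subtracts the mean.  If the mass is zero, the block of the kernel is the
  whole space and nothing remains; the value \<open>0\<close> of \<open>Q_bar\<close> in this case agrees with that.
  The linear algebra is in \<open>pinv_block_fisher\<close>.

  The formula for the gradient has an algebraic and an analytic part.  Algebraically, the backward
  recursion is the adjoint of the linearised forward recursion: pairing the derivative of the state
  pmf with the costate telescopes over time, and what is left of the derivative of the objective
  is the sum of \<open>\<mu> $ s * d\<pi> s a * Q s a\<close>, where only the policy is varied (\<open>d_objective_eq\<close>).  The
  derivative of a softmax policy is the covariance form of that policy, which is also its Fisher
  matrix; summing over the states of an expert gives \<open>d_objective_fisher\<close>.

  Analytically, the objective must be shown to be differentiable with the expected derivative,
  although transition probabilities and rewards of a state \<open>s\<close> are smooth only where \<open>s\<close> has positive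
  probability, and at boundary points of the simplex only continuity of the function and of its
  gradient is known.  Continuity of the gradient yields a derivative within the domain at each of its points
  (\<open>smooth_extension_gradient_has_derivative\<close>).  Where the probability of \<open>s\<close> is zero there is no
  derivative, but then this probability is minimal and thus of smaller than linear order, so that its
  product with a bounded factor has derivative \<open>0\<close> (\<open>weighted_has_derivative\<close>).  Transition
  probabilities are bounded by \<open>1\<close>, and for rewards boundedness is \<open>rewards_bounded_near\<close>.
\<close>

section \<open>Differentiability up to the boundary\<close>

text \<open>
  At points of the domain that are not in its relative interior the extension need not be defined
  on a neighbourhood, so the derivative there has to be recovered from the continuity of the
  gradient.  Shrinking a segment towards a relative interior point moves it into the region where
  the mean value inequality applies, and the estimate survives the limit.
\<close>

lemma smooth_extension_gradient_has_derivative: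
  fixes f :: "'v::euclidean_space \<Rightarrow> real"
  assumes ext: "smooth_extension_gradient f S G" and "convex S" and "x \<in> S"
  shows "(f has_derivative (\<lambda>h. h \<bullet> G x)) (at x within S)"
proof -
  obtain U F where U: "rel_interior S \<subseteq> U"
    and F_eq: "\<And>y. y \<in> S \<Longrightarrow> F y = f y" and F_cont: "continuous_on (U \<union> S) F"
    and F_deriv: "\<And>y. y \<in> U \<Longrightarrow> (F has_derivative (\<lambda>h. h \<bullet> G y)) (at y)"
    and G_cont: "continuous_on (U \<union> S) G"
    using ext unfolding smooth_extension_gradient_def gderiv_def by blast
  obtain c where c: "c \<in> rel_interior S"
    using rel_interior_eq_empty[OF \<open>convex S\<close>] \<open>x \<in> S\<close> by blast
  define shrink where "shrink u \<epsilon> = u - \<epsilon> *\<^sub>R (u - c)" for u and \<epsilon> :: real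
  have "\<exists>d>0. \<forall>y\<in>S. norm (y - x) < d \<longrightarrow> norm (f y - f x - (y - x) \<bullet> G x) \<le> \<eta> * norm (y - x)"
    if "\<eta> > 0" for \<eta>
  proof -
    obtain d where "d > 0" and d: "\<And>z. z \<in> U \<union> S \<Longrightarrow> dist z x < d \<Longrightarrow> dist (G z) (G x) < \<eta>"
      using G_cont \<open>\<eta> > 0\<close> \<open>x \<in> S\<close> unfolding continuous_on_iff by (metis UnI2)
    \<comment> \<open>The region where \<open>F\<close> is differentiable with gradient close to \<open>G x\<close>.\<close>
    define C where "C = ball x d \<inter> rel_interior S"
    have "convex C"
      unfolding C_def by (intro convex_Int convex_ball convex_rel_interior \<open>convex S\<close>)
    have mvt: "norm ((F v - v \<bullet> G x) - (F u - u \<bullet> G x)) \<le> \<eta> * norm (v - u)"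
      if "u \<in> C" "v \<in> C" for u v
    proof (rule differentiable_bound[OF \<open>convex C\<close> _ _ that(2,1)])
      fix z assume z: "z \<in> C"
      then have "z \<in> U" and "dist z x < d"
        using U by (auto simp: C_def dist_commute)
      show "((\<lambda>v. F v - v \<bullet> G x) has_derivative (\<lambda>h. h \<bullet> G z - h \<bullet> G x)) (at z within C)"
        by (intro has_derivative_diff has_derivative_inner_left has_derivative_ident
            has_derivative_at_withinI[OF F_deriv[OF \<open>z \<in> U\<close>]])
      have "dist (G z) (G x) < \<eta>"
        using d \<open>z \<in> U\<close> \<open>dist z x < d\<close> by blast
      show "onorm (\<lambda>h. h \<bullet> G z - h \<bullet> G x) \<le> \<eta>"
      proof (rule onorm_le)
        fix h
        have "norm (h \<bullet> G z - h \<bullet> G x) \<le> norm h * norm (G z - G x)"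
          by (metis inner_diff_right Cauchy_Schwarz_ineq2 real_norm_def)
        also have "\<dots> \<le> norm h * \<eta>"
          using \<open>dist (G z) (G x) < \<eta>\<close> by (intro mult_left_mono) (auto simp: dist_norm)
        finally show "norm (h \<bullet> G z - h \<bullet> G x) \<le> \<eta> * norm h"
          by (simp add: mult.commute)
      qed
    qed
    have "norm (f y - f x - (y - x) \<bullet> G x) \<le> \<eta> * norm (y - x)"
      if "y \<in> S" "norm (y - x) < d" for y
    proof -
      have shrink_lim: "(shrink u \<longlongrightarrow> u) (at_right 0)" for u
        unfolding shrink_def by (rule tendsto_eq_intros refl | simp)+
      have shrink_in: "\<forall>\<^sub>F \<epsilon> in at_right 0. shrink u \<epsilon> \<in> rel_interior S" if "u \<in> S" for u
        unfolding eventually_at_right_field shrink_def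
        using rel_interior_convex_shrink[OF \<open>convex S\<close> c that] by (intro exI[of _ 1]) auto
      have shrink_C: "\<forall>\<^sub>F \<epsilon> in at_right 0. shrink u \<epsilon> \<in> C" if "u \<in> S" "dist u x < d" for u
      proof -
        have "\<forall>\<^sub>F \<epsilon> in at_right 0. shrink u \<epsilon> \<in> ball x d"
          by (rule topological_tendstoD[OF shrink_lim]) (use that in \<open>auto simp: dist_commute\<close>)
        with shrink_in[OF that(1)] show ?thesis
          by eventually_elim (simp add: C_def)
      qed
      have F_lim: "((\<lambda>\<epsilon>. F (shrink u \<epsilon>)) \<longlongrightarrow> f u) (at_right 0)" if "u \<in> S" for u
      proof -
        have "((\<lambda>\<epsilon>. F (shrink u \<epsilon>)) \<longlongrightarrow> F u) (at_right 0)"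
        proof (rule continuous_on_tendsto_compose[OF F_cont shrink_lim])
          show "\<forall>\<^sub>F \<epsilon> in at_right 0. shrink u \<epsilon> \<in> U \<union> S"
            using shrink_in[OF that] by eventually_elim (use U in auto)
        qed (use that in auto)
        then show ?thesis
          by (simp add: F_eq[OF that])
      qed
      have "norm ((f y - y \<bullet> G x) - (f x - x \<bullet> G x)) \<le> \<eta> * norm (y - x)"
      proof (rule tendsto_le)
        show "((\<lambda>\<epsilon>. norm ((F (shrink y \<epsilon>) - shrink y \<epsilon> \<bullet> G x) - (F (shrink x \<epsilon>) - shrink x \<epsilon> \<bullet> G x)))
            \<longlongrightarrow> norm ((f y - y \<bullet> G x) - (f x - x \<bullet> G x))) (at_right 0)"
          by (intro tendsto_intros F_lim shrink_lim \<open>x \<in> S\<close> \<open>y \<in> S\<close>)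
        show "((\<lambda>\<epsilon>. \<eta> * norm (shrink y \<epsilon> - shrink x \<epsilon>)) \<longlongrightarrow> \<eta> * norm (y - x)) (at_right 0)"
          by (intro tendsto_intros shrink_lim)
        have "\<forall>\<^sub>F \<epsilon> in at_right 0. shrink y \<epsilon> \<in> C" "\<forall>\<^sub>F \<epsilon> in at_right 0. shrink x \<epsilon> \<in> C"
          using that \<open>x \<in> S\<close> \<open>d > 0\<close> by (auto intro!: shrink_C simp: dist_norm)
        then show "\<forall>\<^sub>F \<epsilon> in at_right 0.
            norm ((F (shrink y \<epsilon>) - shrink y \<epsilon> \<bullet> G x) - (F (shrink x \<epsilon>) - shrink x \<epsilon> \<bullet> G x))
            \<le> \<eta> * norm (shrink y \<epsilon> - shrink x \<epsilon>)"
          by eventually_elim (rule mvt)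
      qed simp
      then show ?thesis
        by (simp add: inner_diff_left algebra_simps)
    qed
    with \<open>d > 0\<close> show ?thesis
      by blast
  qed
  then show ?thesis
    unfolding has_derivative_within_alt by (simp add: bounded_linear_inner_left)
qed

lemma convex_pmfs_pos: "convex {\<mu> \<in> pmfs. 0 < \<mu> $ s}"
proof -
  have "0 < u * x + v * y" if "0 < x" "0 < y" "0 \<le> u" "0 \<le> v" "u + v = 1" for u v x y :: real
    using that by (cases "u = 0") (auto intro: add_pos_nonneg)
  then show ?thesis
    by (auto simp: convex_def pmfs_def sum.distrib simp flip: sum_distrib_left)
qed

text \<open>
  At a point where the probability of \<open>s\<close> is positive this is the product and chain rule.  Where it
  vanishes, no gradient of \<open>f\<close> is available; but there the probability has a minimum, so it is of
  order \<open>o(dist y x)\<close>, and a bounded factor cannot spoil this.  The formula remains correct because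
  each of its terms contains \<open>\<mu> x $ s\<close> or \<open>\<mu>' h $ s\<close>, which are both zero.
\<close>

lemma weighted_has_derivative:
  fixes \<mu> :: "'p::real_normed_vector \<Rightarrow> real ^ 's::finite"
  assumes \<mu>: "(\<mu> has_derivative \<mu>') (at x)" and pmf: "\<And>y. \<mu> y \<in> pmfs"
    and w: "(w has_derivative w') (at x)"
    and ext: "smooth_extension_gradient f {m \<in> pmfs. 0 < m $ s} G"
    and bdd: "Bfun (\<lambda>y. f (\<mu> y)) (at x within {y. 0 < \<mu> y $ s})"
  shows "((\<lambda>y. \<mu> y $ s * w y * f (\<mu> y)) has_derivative
    (\<lambda>h. (\<mu>' h $ s * w x + \<mu> x $ s * w' h) * f (\<mu> x) + \<mu> x $ s * w x * (\<mu>' h \<bullet> G (\<mu> x)))) (at x)"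
proof -
  have \<mu>_s: "((\<lambda>y. \<mu> y $ s) has_derivative (\<lambda>h. \<mu>' h $ s)) (at x)"
    using \<mu> by (rule bounded_linear.has_derivative[OF bounded_linear_vec_nth])
  have nonneg: "0 \<le> \<mu> y $ s" for y
    using pmf[of y] by (simp add: pmfs_def)
  show ?thesis
  proof (cases "0 < \<mu> x $ s")
    case True
    define P where "P = {y. 0 < \<mu> y $ s}"
    have "((\<lambda>y. \<mu> y $ s) \<longlongrightarrow> \<mu> x $ s) (at x)"
      using has_derivative_continuous[OF \<mu>_s] by (simp add: continuous_within)
    with True have ev: "\<forall>\<^sub>F y in at x. y \<in> P"
      unfolding P_def by (simp add: order_tendstoD)
    with True have "\<forall>\<^sub>F y in nhds x. y \<in> P"
      by (simp add: eventually_nhds_conv_at P_def)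
    then have at_P: "at x within P = at x"
      unfolding eventually_nhds by (meson at_within_open_subset subsetI)
    have "(f has_derivative (\<lambda>h. h \<bullet> G (\<mu> x))) (at (\<mu> x) within {m \<in> pmfs. 0 < m $ s})"
      using ext convex_pmfs_pos True pmf by (intro smooth_extension_gradient_has_derivative) auto
    then have "(f has_derivative (\<lambda>h. h \<bullet> G (\<mu> x))) (at (\<mu> x) within \<mu> ` P)"
      by (rule has_derivative_subset) (auto simp: P_def pmf)
    from has_derivative_in_compose[OF has_derivative_at_withinI[OF \<mu>] this]
    have "((\<lambda>y. f (\<mu> y)) has_derivative (\<lambda>h. \<mu>' h \<bullet> G (\<mu> x))) (at x within P)" .
    then have f\<mu>: "((\<lambda>y. f (\<mu> y)) has_derivative (\<lambda>h. \<mu>' h \<bullet> G (\<mu> x))) (at x)"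
      using at_P by simp
    show ?thesis
      by (rule has_derivative_eq_rhs[OF has_derivative_mult[OF has_derivative_mult[OF \<mu>_s w] f\<mu>]])
        (auto simp: algebra_simps)
  next
    case False
    then have zero: "\<mu> x $ s = 0"
      using nonneg[of x] by simp
    have "(\<lambda>h. \<mu>' h $ s) = (\<lambda>h. 0)"
      by (rule has_derivative_local_min[OF \<mu>_s]) (simp add: zero nonneg)
    then have \<mu>'_zero: "\<mu>' h $ s = 0" for h
      by meson
    have small: "((\<lambda>y. \<mu> y $ s / norm (y - x)) \<longlongrightarrow> 0) (at x)"
      using \<mu>_s by (simp add: has_derivative_iff_norm \<mu>'_zero zero nonneg)
    have bdd': "Bfun (\<lambda>y. if 0 < \<mu> y $ s then f (\<mu> y) else 0) (at x)"
      using bdd unfolding Bfun_def eventually_at_filter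
      by (auto elim!: eventually_mono)
    have "(w \<longlongrightarrow> w x) (at x)"
      using has_derivative_continuous[OF w] by (simp add: continuous_within)
    from tendsto_mult[OF small this]
    have "Zfun (\<lambda>y. \<mu> y $ s / norm (y - x) * w y) (at x)"
      by (simp add: tendsto_Zfun_iff)
    from bounded_bilinear.Zfun_prod_Bfun[OF bounded_bilinear_mult this bdd']
    have "((\<lambda>y. \<mu> y $ s / norm (y - x) * w y * (if 0 < \<mu> y $ s then f (\<mu> y) else 0)) \<longlongrightarrow> 0) (at x)"
      by (simp add: tendsto_Zfun_iff)
    also have "(\<lambda>y. \<mu> y $ s / norm (y - x) * w y * (if 0 < \<mu> y $ s then f (\<mu> y) else 0)) =
        (\<lambda>y. (\<mu> y $ s * w y * f (\<mu> y)) /\<^sub>R norm (y - x))"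
      using nonneg by (auto simp: fun_eq_iff divide_inverse_commute order.order_iff_strict)
    finally show ?thesis
      by (intro has_derivativeI) (simp_all add: zero \<mu>'_zero)
  qed
qed

section \<open>Derivatives along the forward recursion\<close>

lemma softmax_sum_pos: "0 < (\<Sum>b\<in>UNIV. exp (\<psi> $ b))" for \<psi> :: "real ^ 'a::finite"
  by (rule sum_pos) auto

lemma softmax_pos: "0 < softmax \<psi> $ a"
  using softmax_sum_pos[of \<psi>] by (simp add: softmax_def)

lemma sum_softmax: "(\<Sum>a\<in>UNIV. softmax \<psi> $ a) = 1"
  using softmax_sum_pos[of \<psi>] by (simp add: softmax_def flip: sum_divide_distrib)

lemma policy_pmf: "0 < policy e g t s a" "(\<Sum>a\<in>UNIV. policy e g t s a) = 1"
  by (simp_all add: policy_def softmax_pos sum_softmax)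

lemma has_derivative_softmax:
  assumes "(\<psi> has_derivative \<psi>') (at x)"
  shows "((\<lambda>y. softmax (\<psi> y) $ a) has_derivative
    (\<lambda>h. softmax (\<psi> x) $ a * (\<psi>' h $ a - (\<Sum>b\<in>UNIV. softmax (\<psi> x) $ b * \<psi>' h $ b)))) (at x)"
proof -
  have nth: "((\<lambda>y. \<psi> y $ b) has_derivative (\<lambda>h. \<psi>' h $ b)) (at x)" for b
    using assms by (rule bounded_linear.has_derivative[OF bounded_linear_vec_nth])
  have ex: "((\<lambda>y. exp (\<psi> y $ b)) has_derivative (\<lambda>h. \<psi>' h $ b * exp (\<psi> x $ b))) (at x)" for b
    by (rule has_derivative_eq_rhs[OF has_derivative_exp[OF nth]]) auto
  define Z where "Z = (\<Sum>b\<in>UNIV. exp (\<psi> x $ b))"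
  have "Z \<noteq> 0"
    using softmax_sum_pos[of "\<psi> x"] by (simp add: Z_def)
  have "((\<lambda>y. exp (\<psi> y $ a) / (\<Sum>b\<in>UNIV. exp (\<psi> y $ b))) has_derivative
    (\<lambda>h. (\<psi>' h $ a * exp (\<psi> x $ a) * Z - exp (\<psi> x $ a) * (\<Sum>b\<in>UNIV. \<psi>' h $ b * exp (\<psi> x $ b)))
      / (Z * Z))) (at x)"
    unfolding Z_def
    by (rule has_derivative_divide'[OF ex has_derivative_sum[OF ex]])
       (use \<open>Z \<noteq> 0\<close> in \<open>simp add: Z_def\<close>)
  then show ?thesis
    unfolding softmax_def vec_lambda_beta Z_def[symmetric]
    by (rule has_derivative_eq_rhs)
      (use \<open>Z \<noteq> 0\<close> in \<open>simp add: fun_eq_iff field_simps sum_divide_distrib[symmetric]\<close>)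
qed

text \<open>
  The logarithmic derivative of the \<open>a\<close>-th softmax probability is the \<open>a\<close>-th component of the
  direction minus the mean of the direction under the softmax.
\<close>

definition d_policy ::
    "('s \<Rightarrow> 'z) \<Rightarrow> (nat \<Rightarrow> 'z \<Rightarrow> real ^ 'a) \<Rightarrow> (nat \<Rightarrow> 'z \<Rightarrow> real ^ 'a) \<Rightarrow> nat \<Rightarrow> 's \<Rightarrow> 'a::finite \<Rightarrow> real"
  where "d_policy e g h t s a =
    policy e g t s a * (h t (e s) $ a - (\<Sum>b\<in>UNIV. policy e g t s b * h t (e s) $ b))"

lemma bounded_linear_blocks: "bounded_linear (\<lambda>\<gamma>. blocks \<iota> \<gamma> t z)"
  by (rule linear_conv_bounded_linear[THEN iffD1])
    (auto simp: linear_iff blocks_def vec_eq_iff)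

lemma has_derivative_policy:
  "((\<lambda>\<gamma>'. policy e (blocks \<iota> \<gamma>') t s a) has_derivative
    (\<lambda>h. d_policy e (blocks \<iota> \<gamma>) (blocks \<iota> h) t s a)) (at \<gamma>)"
  unfolding policy_def d_policy_def
  by (rule has_derivative_softmax bounded_linear_imp_has_derivative bounded_linear_blocks)+

lemma state_pmf_in_pmfs:
  assumes "nonlinear_mdp M" and "t \<le> horizon M"
  shows "state_pmf M e g t \<in> pmfs"
  using assms(2)
proof (induction t)
  case 0
  with assms(1) show ?case
    by (simp add: nonlinear_mdp_def)
next
  case (Suc t)
  let ?\<mu> = "state_pmf M e g t"
  have \<mu>: "?\<mu> \<in> pmfs"
    using Suc by simp
  then have p: "trans M t ?\<mu> s a \<in> pmfs" for s a
    using assms(1) Suc.prems by (simp add: nonlinear_mdp_def)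
  have "(\<Sum>s'\<in>UNIV. state_pmf M e g (Suc t) $ s') =
      (\<Sum>s\<in>UNIV. \<Sum>a\<in>UNIV. \<Sum>s'\<in>UNIV. ?\<mu> $ s * policy e g t s a * trans M t ?\<mu> s a $ s')"
    by (simp, subst sum.swap, rule sum.cong[OF refl], rule sum.swap)
  also have "\<dots> = 1"
    using p \<mu> by (simp add: pmfs_def policy_pmf flip: sum_distrib_left)
  finally show ?case
    using p \<mu> by (auto simp: pmfs_def intro!: sum_nonneg mult_nonneg_nonneg less_imp_le[OF policy_pmf(1)])
qed

text \<open>
  The derivative of \<open>\<Sum>s a. \<mu> $ s * \<pi> s a * f s a\<close> when \<open>\<mu>\<close> and \<open>\<pi>\<close> move with velocities \<open>d\<mu>\<close> and
  \<open>d\<pi>\<close>, and \<open>f s a\<close> is a function of \<open>\<mu>\<close> with gradient \<open>df s a\<close>.  State pmfs and rewards are both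
  averages of this kind.
\<close>

definition d_average ::
    "real ^ 's::finite \<Rightarrow> real ^ 's \<Rightarrow> ('s \<Rightarrow> 'a::finite \<Rightarrow> real) \<Rightarrow> ('s \<Rightarrow> 'a \<Rightarrow> real) \<Rightarrow>
     ('s \<Rightarrow> 'a \<Rightarrow> real) \<Rightarrow> ('s \<Rightarrow> 'a \<Rightarrow> real ^ 's) \<Rightarrow> real" where
  "d_average \<mu> d\<mu> \<pi> d\<pi> f df = (\<Sum>s\<in>UNIV. \<Sum>a\<in>UNIV.
     (d\<mu> $ s * \<pi> s a + \<mu> $ s * d\<pi> s a) * f s a + \<mu> $ s * \<pi> s a * (d\<mu> \<bullet> df s a))"

lemma has_derivative_average:
  fixes \<mu> :: "real ^ ('t::finite \<times> 'z::finite \<times> 'a::finite) \<Rightarrow> real ^ 's::finite"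
  assumes "(\<mu> has_derivative \<mu>') (at \<gamma>)" and "\<And>\<gamma>'. \<mu> \<gamma>' \<in> pmfs"
    and "\<And>s a. smooth_extension_gradient (f s a) {m \<in> pmfs. 0 < m $ s} (df s a)"
    and "\<And>s a. Bfun (\<lambda>\<gamma>'. f s a (\<mu> \<gamma>')) (at \<gamma> within {\<gamma>'. 0 < \<mu> \<gamma>' $ s})"
  shows "((\<lambda>\<gamma>'. \<Sum>s\<in>UNIV. \<Sum>a\<in>UNIV. \<mu> \<gamma>' $ s * policy e (blocks \<iota> \<gamma>') t s a * f s a (\<mu> \<gamma>'))
    has_derivative (\<lambda>h. d_average (\<mu> \<gamma>) (\<mu>' h) (policy e (blocks \<iota> \<gamma>) t)
      (d_policy e (blocks \<iota> \<gamma>) (blocks \<iota> h) t) (\<lambda>s a. f s a (\<mu> \<gamma>)) (\<lambda>s a. df s a (\<mu> \<gamma>)))) (at \<gamma>)"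
  unfolding d_average_def
  by (intro has_derivative_sum weighted_has_derivative assms has_derivative_policy)

primrec d_state_pmf ::
    "('s::finite, 'a::finite) mdp \<Rightarrow> ('s, 'a) mdp_gradients \<Rightarrow> ('s \<Rightarrow> 'z) \<Rightarrow>
     (nat \<Rightarrow> 'z \<Rightarrow> real ^ 'a) \<Rightarrow> (nat \<Rightarrow> 'z \<Rightarrow> real ^ 'a) \<Rightarrow> nat \<Rightarrow> real ^ 's" where
  "d_state_pmf M D e g h 0 = 0"
| "d_state_pmf M D e g h (Suc t) =
     (\<chi> s'. d_average (state_pmf M e g t) (d_state_pmf M D e g h t) (policy e g t) (d_policy e g h t)
        (\<lambda>s a. trans M t (state_pmf M e g t) s a $ s')
        (\<lambda>s a. d_trans D t (state_pmf M e g t) s a s'))"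

lemma has_derivative_vec_componentwise:
  fixes f :: "'p::real_normed_vector \<Rightarrow> real ^ 'n::finite"
  assumes "\<And>i. ((\<lambda>x. f x $ i) has_derivative (\<lambda>h. f' h $ i)) (at x)"
  shows "(f has_derivative f') (at x)"
  unfolding has_derivative_componentwise_within[of f]
  using assms by (auto simp: Basis_vec_def inner_axis)

lemma has_derivative_state_pmf:
  fixes M :: "('s::finite, 'a::finite) mdp" and e :: "'s \<Rightarrow> 'z::finite"
    and \<gamma> :: "real ^ ('t::finite \<times> 'z \<times> 'a)"
  assumes M: "nonlinear_mdp M" and D: "extension_gradients M D" and "t \<le> horizon M"
  shows "((\<lambda>\<gamma>'. state_pmf M e (blocks \<iota> \<gamma>') t) has_derivative
    (\<lambda>h. d_state_pmf M D e (blocks \<iota> \<gamma>) (blocks \<iota> h) t)) (at \<gamma>)"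
  using assms(3)
proof (induction t)
  case 0
  show ?case
    by simp
next
  case (Suc t)
  let ?\<mu> = "\<lambda>\<gamma>'. state_pmf M e (blocks \<iota> \<gamma>') t"
  have t: "t < horizon M"
    using Suc.prems by simp
  have pmf: "?\<mu> \<gamma>' \<in> pmfs" for \<gamma>'
    using M t by (simp add: state_pmf_in_pmfs)
  have bdd: "norm (trans M t (?\<mu> \<gamma>') s a $ s') \<le> 1" for \<gamma>' s a s'
  proof -
    have p: "trans M t (?\<mu> \<gamma>') s a \<in> pmfs"
      using M pmf t by (simp add: nonlinear_mdp_def)
    then have "trans M t (?\<mu> \<gamma>') s a $ s' \<le> (\<Sum>s'\<in>UNIV. trans M t (?\<mu> \<gamma>') s a $ s')"
      by (intro member_le_sum) (auto simp: pmfs_def)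
    with p show ?thesis
      by (simp add: pmfs_def)
  qed
  have "((\<lambda>\<gamma>'. \<Sum>s\<in>UNIV. \<Sum>a\<in>UNIV. ?\<mu> \<gamma>' $ s * policy e (blocks \<iota> \<gamma>') t s a *
        trans M t (?\<mu> \<gamma>') s a $ s') has_derivative
      (\<lambda>h. d_average (?\<mu> \<gamma>) (d_state_pmf M D e (blocks \<iota> \<gamma>) (blocks \<iota> h) t)
        (policy e (blocks \<iota> \<gamma>) t) (d_policy e (blocks \<iota> \<gamma>) (blocks \<iota> h) t)
        (\<lambda>s a. trans M t (?\<mu> \<gamma>) s a $ s') (\<lambda>s a. d_trans D t (?\<mu> \<gamma>) s a s'))) (at \<gamma>)" for s'
    using D t bdd Suc.IH
    by (intro has_derivative_average[where f = "\<lambda>s a m. trans M t m s a $ s'"] pmf)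
      (auto simp: extension_gradients_def intro!: BfunI[where K = 1] always_eventually)
  then show ?case
    by (intro has_derivative_vec_componentwise) simp
qed

section \<open>The gradient of the objective by the backward recursion\<close>

definition d_objective ::
    "('s::finite, 'a::finite) mdp \<Rightarrow> ('s, 'a) mdp_gradients \<Rightarrow> ('s \<Rightarrow> 'z) \<Rightarrow>
     (nat \<Rightarrow> 'z \<Rightarrow> real ^ 'a) \<Rightarrow> (nat \<Rightarrow> 'z \<Rightarrow> real ^ 'a) \<Rightarrow> real" where
  "d_objective M D e g h =
     (\<Sum>t<horizon M. d_average (state_pmf M e g t) (d_state_pmf M D e g h t)
        (policy e g t) (d_policy e g h t)
        (reward M t (state_pmf M e g t)) (d_reward D t (state_pmf M e g t))) +
     (\<Sum>s\<in>UNIV. d_state_pmf M D e g h (horizon M) $ s * final_reward M (state_pmf M e g (horizon M)) s +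
        state_pmf M e g (horizon M) $ s *
          (d_state_pmf M D e g h (horizon M) \<bullet> d_final_reward D (state_pmf M e g (horizon M)) s))"

lemma has_derivative_objective:
  fixes M :: "('s::finite, 'a::finite) mdp" and e :: "'s \<Rightarrow> 'z::finite"
    and \<gamma> :: "real ^ ('t::finite \<times> 'z \<times> 'a)"
  assumes M: "nonlinear_mdp M" and D: "extension_gradients M D"
    and bdd: "rewards_bounded_near M e \<iota> \<gamma>"
  shows "((\<lambda>\<gamma>'. objective M e (blocks \<iota> \<gamma>')) has_derivative
    (\<lambda>h. d_objective M D e (blocks \<iota> \<gamma>) (blocks \<iota> h))) (at \<gamma>)"
  unfolding objective_def d_objective_def
proof (rule has_derivative_add[OF has_derivative_sum has_derivative_sum])
  fix t assume t: "t \<in> {..<horizon M}"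
  show "((\<lambda>\<gamma>'. \<Sum>s\<in>UNIV. \<Sum>a\<in>UNIV. state_pmf M e (blocks \<iota> \<gamma>') t $ s * policy e (blocks \<iota> \<gamma>') t s a *
        reward M t (state_pmf M e (blocks \<iota> \<gamma>') t) s a) has_derivative
      (\<lambda>h. d_average (state_pmf M e (blocks \<iota> \<gamma>) t) (d_state_pmf M D e (blocks \<iota> \<gamma>) (blocks \<iota> h) t)
        (policy e (blocks \<iota> \<gamma>) t) (d_policy e (blocks \<iota> \<gamma>) (blocks \<iota> h) t)
        (reward M t (state_pmf M e (blocks \<iota> \<gamma>) t))
        (d_reward D t (state_pmf M e (blocks \<iota> \<gamma>) t)))) (at \<gamma>)"
    using D bdd t
    by (intro has_derivative_average[where f = "\<lambda>s a m. reward M t m s a"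
          and df = "\<lambda>s a m. d_reward D t m s a"] has_derivative_state_pmf state_pmf_in_pmfs M)
      (auto simp: extension_gradients_def rewards_bounded_near_def)
next
  fix s
  have "((\<lambda>\<gamma>'. state_pmf M e (blocks \<iota> \<gamma>') (horizon M) $ s * 1 *
        final_reward M (state_pmf M e (blocks \<iota> \<gamma>') (horizon M)) s) has_derivative
      (\<lambda>h. (d_state_pmf M D e (blocks \<iota> \<gamma>) (blocks \<iota> h) (horizon M) $ s * 1 +
          state_pmf M e (blocks \<iota> \<gamma>) (horizon M) $ s * 0) *
          final_reward M (state_pmf M e (blocks \<iota> \<gamma>) (horizon M)) s +
        state_pmf M e (blocks \<iota> \<gamma>) (horizon M) $ s * 1 *
          (d_state_pmf M D e (blocks \<iota> \<gamma>) (blocks \<iota> h) (horizon M) \<bullet>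
           d_final_reward D (state_pmf M e (blocks \<iota> \<gamma>) (horizon M)) s))) (at \<gamma>)"
    using D bdd
    by (intro weighted_has_derivative[where f = "\<lambda>m. final_reward M m s"
          and G = "\<lambda>m. d_final_reward D m s"]
        has_derivative_state_pmf state_pmf_in_pmfs M has_derivative_const)
      (auto simp: extension_gradients_def rewards_bounded_near_def)
  then show "((\<lambda>\<gamma>'. state_pmf M e (blocks \<iota> \<gamma>') (horizon M) $ s *
        final_reward M (state_pmf M e (blocks \<iota> \<gamma>') (horizon M)) s) has_derivative
      (\<lambda>h. d_state_pmf M D e (blocks \<iota> \<gamma>) (blocks \<iota> h) (horizon M) $ s *
          final_reward M (state_pmf M e (blocks \<iota> \<gamma>) (horizon M)) s +
        state_pmf M e (blocks \<iota> \<gamma>) (horizon M) $ s *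
          (d_state_pmf M D e (blocks \<iota> \<gamma>) (blocks \<iota> h) (horizon M) \<bullet>
           d_final_reward D (state_pmf M e (blocks \<iota> \<gamma>) (horizon M)) s))) (at \<gamma>)"
    by simp
qed

lemma d_average_add:
  "d_average \<mu> d\<mu> \<pi> d\<pi> (\<lambda>s a. f s a + f' s a) (\<lambda>s a. df s a + df' s a) =
    d_average \<mu> d\<mu> \<pi> d\<pi> f df + d_average \<mu> d\<mu> \<pi> d\<pi> f' df'"
  by (simp add: d_average_def inner_add_right algebra_simps flip: sum.distrib)

lemma d_average_scaleR:
  "d_average \<mu> d\<mu> \<pi> d\<pi> (\<lambda>s a. f s a * c) (\<lambda>s a. c *\<^sub>R df s a) = d_average \<mu> d\<mu> \<pi> d\<pi> f df * c"
  by (simp add: d_average_def sum_distrib_left algebra_simps)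

lemma d_average_sum:
  assumes "finite I"
  shows "d_average \<mu> d\<mu> \<pi> d\<pi> (\<lambda>s a. \<Sum>i\<in>I. f i s a) (\<lambda>s a. \<Sum>i\<in>I. df i s a) =
    (\<Sum>i\<in>I. d_average \<mu> d\<mu> \<pi> d\<pi> (f i) (df i))"
  using assms by (induction I rule: finite_induct) (simp_all add: d_average_add, simp add: d_average_def)

text \<open>
  The adjoint relation for one time step.  The backward recursion collects exactly the terms through
  which the current state pmf influences the immediate reward and, via the next state pmf, the
  remaining ones; they all appear in the pairing with the current costate, so that only the direct
  effect of the policy is left.
\<close>

lemma costate_step:
  assumes "t < horizon M"
  shows "d_average (state_pmf M e g t) (d_state_pmf M D e g h t) (policy e g t) (d_policy e g h t)
      (reward M t (state_pmf M e g t)) (d_reward D t (state_pmf M e g t)) +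
      d_state_pmf M D e g h (Suc t) \<bullet> costate M D e g (Suc t) =
    d_state_pmf M D e g h t \<bullet> costate M D e g t +
      (\<Sum>s\<in>UNIV. \<Sum>a\<in>UNIV. state_pmf M e g t $ s * d_policy e g h t s a *
        Q_fun M t (state_pmf M e g t) (costate M D e g (Suc t)) s a)"
    (is "?r + ?next = ?cur + ?direct")
proof -
  define \<mu> d\<mu> \<pi> d\<pi> \<sigma> where defs: "\<mu> = state_pmf M e g t" "d\<mu> = d_state_pmf M D e g h t"
    "\<pi> = policy e g t" "d\<pi> = d_policy e g h t" "\<sigma> = costate M D e g (Suc t)"
  \<comment> \<open>The reward and the transitions paired with the next costate combine to \<^const>\<open>Q_fun\<close>.\<close>
  have "?next = (\<Sum>s'\<in>UNIV. d_average \<mu> d\<mu> \<pi> d\<pi> (\<lambda>s a. trans M t \<mu> s a $ s' * \<sigma> $ s')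
      (\<lambda>s a. \<sigma> $ s' *\<^sub>R d_trans D t \<mu> s a s'))"
    by (simp add: inner_vec_def defs d_average_scaleR)
  then have "?r + ?next = d_average \<mu> d\<mu> \<pi> d\<pi> (Q_fun M t \<mu> \<sigma>) (d_Q_fun D t \<mu> \<sigma>)"
    unfolding defs(1-4)[symmetric]
    by (simp add: Q_fun_def[abs_def] d_Q_fun_def[abs_def] d_average_add d_average_sum)
  also have "\<dots> = (\<Sum>s\<in>UNIV. \<Sum>a\<in>UNIV. d\<mu> $ s * \<pi> s a * Q_fun M t \<mu> \<sigma> s a) +
      (\<Sum>s'\<in>UNIV. \<Sum>a\<in>UNIV. \<mu> $ s' * \<pi> s' a * (d\<mu> \<bullet> d_Q_fun D t \<mu> \<sigma> s' a)) +
      (\<Sum>s\<in>UNIV. \<Sum>a\<in>UNIV. \<mu> $ s * d\<pi> s a * Q_fun M t \<mu> \<sigma> s a)"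
    by (simp add: d_average_def algebra_simps sum.distrib)
  also have "(\<Sum>s'\<in>UNIV. \<Sum>a\<in>UNIV. \<mu> $ s' * \<pi> s' a * (d\<mu> \<bullet> d_Q_fun D t \<mu> \<sigma> s' a)) =
      d\<mu> \<bullet> (\<Sum>s'\<in>UNIV. \<Sum>a\<in>UNIV. (\<mu> $ s' * \<pi> s' a) *\<^sub>R d_Q_fun D t \<mu> \<sigma> s' a)"
    by (simp add: inner_sum_right)
  also have "(\<Sum>s\<in>UNIV. \<Sum>a\<in>UNIV. d\<mu> $ s * \<pi> s a * Q_fun M t \<mu> \<sigma> s a) + \<dots> = ?cur"
    using assms
    by (subst costate.simps)
      (simp add: Let_def inner_vec_def distrib_left sum.distrib sum_distrib_left mult.assoc
        sum_component flip: defs)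
  finally show ?thesis
    by (simp add: defs)
qed

text \<open>
  Summing the one-step relation over time telescopes; the boundary terms are the derivative of the
  terminal reward and that of the initial pmf, which is constant.
\<close>

lemma d_objective_eq:
  "d_objective M D e g h = (\<Sum>t<horizon M. \<Sum>s\<in>UNIV. \<Sum>a\<in>UNIV.
     state_pmf M e g t $ s * d_policy e g h t s a *
       Q_fun M t (state_pmf M e g t) (costate M D e g (Suc t)) s a)"
proof -
  define pair where "pair t = d_state_pmf M D e g h t \<bullet> costate M D e g t" for t
  define \<mu> d\<mu> where defs: "\<mu> = state_pmf M e g (horizon M)" "d\<mu> = d_state_pmf M D e g h (horizon M)"
  have "pair (horizon M) = (\<Sum>s\<in>UNIV. d\<mu> $ s * final_reward M \<mu> s) +
      d\<mu> \<bullet> (\<Sum>s\<in>UNIV. \<mu> $ s *\<^sub>R d_final_reward D \<mu> s)"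
    unfolding pair_def
    by (subst costate.simps)
      (simp add: Let_def inner_vec_def distrib_left sum.distrib sum_component flip: defs)
  also have "\<dots> = (\<Sum>s\<in>UNIV. d\<mu> $ s * final_reward M \<mu> s + \<mu> $ s * (d\<mu> \<bullet> d_final_reward D \<mu> s))"
    by (simp add: inner_sum_right sum.distrib)
  finally have final: "\<dots> = pair (horizon M)" ..
  have "d_objective M D e g h = (\<Sum>t<horizon M. d_average (state_pmf M e g t) (d_state_pmf M D e g h t)
        (policy e g t) (d_policy e g h t)
        (reward M t (state_pmf M e g t)) (d_reward D t (state_pmf M e g t))) + pair (horizon M)"
    by (simp only: d_objective_def final[unfolded defs])
  also have "pair (horizon M) = (\<Sum>t<horizon M. pair (Suc t) - pair t)"
    by (simp only: sum_lessThan_telescope) (simp add: pair_def)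
  finally show ?thesis
    using costate_step[of _ M e g D h]
    by (simp add: pair_def add_diff_eq flip: sum.distrib)
qed

section \<open>The Moore-Penrose inverse of the approximate Fisher matrix\<close>

lemma moore_penrose_unique:
  assumes X: "moore_penrose A X" and Y: "moore_penrose A Y"
  shows "X = Y"
proof -
  have "A ** X = transpose ((A ** Y ** A) ** X)"
    using X Y by (simp add: moore_penrose_def)
  also have "\<dots> = transpose (A ** X) ** transpose (A ** Y)"
    by (simp add: matrix_transpose_mul matrix_mul_assoc)
  also have "\<dots> = (A ** X ** A) ** Y"
    using X Y by (simp add: moore_penrose_def matrix_mul_assoc)
  finally have AX: "A ** X = A ** Y"
    using X by (simp add: moore_penrose_def)
  have "X ** A = transpose (X ** (A ** Y ** A))"
    using X Y by (simp add: moore_penrose_def)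
  also have "\<dots> = transpose (Y ** A) ** transpose (X ** A)"
    by (simp add: matrix_transpose_mul matrix_mul_assoc)
  also have "\<dots> = Y ** A ** (X ** A)"
    using X Y by (simp add: moore_penrose_def)
  also have "\<dots> = Y ** (A ** X ** A)"
    by (simp only: matrix_mul_assoc)
  finally have XA: "X ** A = Y ** A"
    using X by (simp only: moore_penrose_def)
  have "X = X ** A ** X"
    using X by (simp add: moore_penrose_def)
  also have "\<dots> = Y ** (A ** X)"
    by (simp add: XA matrix_mul_assoc)
  also have "\<dots> = Y"
    using Y by (simp add: AX matrix_mul_assoc moore_penrose_def)
  finally show ?thesis .
qed

lemma pinv_eqI: "moore_penrose A X \<Longrightarrow> pinv A = X"
  unfolding pinv_def by (blast intro: the_equality moore_penrose_unique)

lemma matrix_add_rdistrib: "(A + B) ** C = A ** C + B ** C"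
  for A B :: "real ^ 'm ^ 'n" and C :: "real ^ 'k ^ 'm"
  by (simp add: matrix_eq algebra_simps flip: matrix_vector_mul_assoc)

lemma matrix_diff_ldistrib: "A ** (B - C) = A ** B - A ** C"
  for A :: "real ^ 'm ^ 'n" and B C :: "real ^ 'k ^ 'm"
  by (simp add: matrix_eq algebra_simps flip: matrix_vector_mul_assoc)

lemma matrix_diff_rdistrib: "(A - B) ** C = A ** C - B ** C"
  for A B :: "real ^ 'm ^ 'n" and C :: "real ^ 'k ^ 'm"
  by (simp add: matrix_eq algebra_simps flip: matrix_vector_mul_assoc)

text \<open>
  If \<open>K\<close> is the orthogonal projection onto the kernel of the symmetric matrix \<open>A\<close>, then \<open>A + K\<close> is
  invertible, and its inverse acts as a pseudoinverse of \<open>A\<close> on the range of \<open>A\<close> and as the identity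
  on the kernel.  Subtracting \<open>K\<close> removes the latter part.
\<close>

lemma pinv_mult_self:
  fixes A K :: "real ^ 'n ^ 'n"
  assumes sym: "transpose A = A" "transpose K = K" and idem: "K ** K = K" and AK: "A ** K = 0"
    and ker: "\<And>v. A *v v = 0 \<Longrightarrow> K *v v = 0 \<Longrightarrow> v = 0"
  shows "pinv A *v (A *v q) = q - K *v q"
proof -
  have KA: "K ** A = 0"
    using arg_cong[OF AK, of transpose] by (simp add: matrix_transpose_mul sym) (simp add: transpose_def vec_eq_iff)
  have "v = 0" if "(A + K) *v v = 0" for v
  proof (rule ker)
    have "K *v v = K *v ((A + K) *v v)"
      by (simp add: matrix_vector_mul_assoc matrix_add_ldistrib KA idem)
    with that show "K *v v = 0"
      by simp
    with that show "A *v v = 0"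
      by (simp add: matrix_vector_mult_add_rdistrib)
  qed
  then obtain N where N: "N ** (A + K) = mat 1"
    using matrix_left_invertible_ker[of "A + K"] by blast
  then have N': "(A + K) ** N = mat 1"
    using matrix_left_right_inverse by blast
  have "N ** K = N ** ((A + K) ** K)"
    by (simp add: matrix_add_rdistrib AK idem)
  then have NK: "N ** K = K"
    by (simp add: matrix_mul_assoc N)
  have "K ** N = K ** (A + K) ** N"
    by (simp add: matrix_add_ldistrib KA idem)
  then have KN: "K ** N = K"
    by (simp add: N' flip: matrix_mul_assoc)
  define X where "X = N - K"
  have AX: "A ** X = mat 1 - K"
    using N' by (simp add: X_def matrix_diff_ldistrib AK matrix_add_rdistrib KN eq_diff_eq)
  have XA: "X ** A = mat 1 - K"
    using N by (simp add: X_def matrix_diff_rdistrib KA matrix_add_ldistrib NK eq_diff_eq)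
  have sym': "transpose (mat 1 - K) = mat 1 - K"
    using sym by (simp add: vec_eq_iff transpose_def mat_def)
  have "A ** X ** A = A"
    by (simp add: AX matrix_diff_rdistrib KA)
  moreover have "X ** A ** X = X"
    by (simp add: XA matrix_diff_rdistrib) (simp add: X_def matrix_diff_ldistrib KN idem)
  ultimately have "moore_penrose A X"
    by (simp add: moore_penrose_def AX XA sym')
  then show ?thesis
    by (simp add: pinv_eqI matrix_vector_mul_assoc XA matrix_vector_mult_diff_rdistrib)
qed

definition block_diag ::
    "('t::finite \<Rightarrow> 'z::finite \<Rightarrow> real ^ 'a ^ 'a::finite) \<Rightarrow> real ^ ('t \<times> 'z \<times> 'a) ^ ('t \<times> 'z \<times> 'a)" where
  "block_diag B = (\<chi> i j. case (i, j) of ((n, z, a), (n', z', a')) \<Rightarrow>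
     if n = n' \<and> z = z' then B n z $ a $ a' else 0)"

lemma sum_blocks:
  fixes f :: "'t::finite \<times> 'z::finite \<times> 'a::finite \<Rightarrow> 'b::comm_monoid_add"
  shows "(\<Sum>i\<in>UNIV. f i) = (\<Sum>n\<in>UNIV. \<Sum>z\<in>UNIV. \<Sum>a\<in>UNIV. f (n, z, a))"
  by (simp add: sum.cartesian_product' flip: UNIV_Times_UNIV)

lemma sum_diag_block:
  fixes f :: "'t::finite \<Rightarrow> 'z::finite \<Rightarrow> 'b::comm_monoid_add"
  shows "(\<Sum>n'\<in>UNIV. \<Sum>z'\<in>UNIV. if n = n' \<and> z = z' then f n' z' else 0) = f n z"
proof -
  have "(\<Sum>z'\<in>UNIV. if n = n' \<and> z = z' then f n' z' else 0) = (if n = n' then f n' z else 0)" for n'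
    by (cases "n = n'") auto
  then show ?thesis
    by simp
qed

lemma block_diag_mult_vec:
  "(block_diag B *v v) $ (n, z, a) = (B n z *v (\<chi> b. v $ (n, z, b))) $ a"
proof -
  have "(block_diag B *v v) $ (n, z, a) = (\<Sum>n'\<in>UNIV. \<Sum>z'\<in>UNIV.
      if n = n' \<and> z = z' then \<Sum>b\<in>UNIV. B n' z' $ a $ b * v $ (n', z', b) else 0)"
    unfolding matrix_vector_mult_def block_diag_def vec_lambda_beta sum_blocks
    by (intro sum.cong refl) auto
  then show ?thesis
    by (simp add: sum_diag_block matrix_vector_mult_def)
qed

lemma block_diag_mult: "block_diag B ** block_diag C = block_diag (\<lambda>n z. B n z ** C n z)"
  by (subst matrix_eq)
    (simp add: vec_eq_iff block_diag_mult_vec flip: matrix_vector_mul_assoc)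

lemma transpose_block_diag: "transpose (block_diag B) = block_diag (\<lambda>n z. transpose (B n z))"
  by (auto simp: transpose_def block_diag_def vec_eq_iff)

lemma gradient_eqI:
  assumes "GDERIV f x :> G"
  shows "gradient f x = G"
  unfolding gradient_def
proof (rule the_equality)
  fix H assume "GDERIV f x :> H"
  with assms have "(\<lambda>h. h \<bullet> H) = (\<lambda>h. h \<bullet> G)"
    unfolding gderiv_def by (rule has_derivative_unique[rotated])
  then show "H = G"
    by (metis inner_commute vector_eq_ldot)
qed (fact assms)

lemma gradient_ln_softmax: "gradient (\<lambda>\<phi>. ln (softmax \<phi> $ a)) \<psi> = axis a 1 - softmax \<psi>"
proof (rule gradient_eqI)
  have "((\<lambda>\<phi>. ln (softmax \<phi> $ a)) has_derivative (\<lambda>h. inverse (softmax \<psi> $ a) *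
      (softmax \<psi> $ a * (h $ a - (\<Sum>b\<in>UNIV. softmax \<psi> $ b * h $ b))))) (at \<psi>)"
    by (rule has_derivative_eq_rhs[OF has_derivative_ln])
       (rule softmax_pos has_derivative_softmax has_derivative_ident | simp add: fun_eq_iff)+
  also have "(\<lambda>h. inverse (softmax \<psi> $ a) *
      (softmax \<psi> $ a * (h $ a - (\<Sum>b\<in>UNIV. softmax \<psi> $ b * h $ b)))) =
      (\<lambda>h. h \<bullet> (axis a 1 - softmax \<psi>))"
    using softmax_pos[of \<psi> a]
    by (simp add: fun_eq_iff inner_diff_right inner_axis inner_commute[of _ "softmax \<psi>"])
      (simp add: inner_vec_def)
  finally show "GDERIV (\<lambda>\<phi>. ln (softmax \<phi> $ a)) \<psi> :> axis a 1 - softmax \<psi>"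
    by (simp add: gderiv_def)
qed

lemma softmax_fisher_nth:
  "softmax_fisher \<psi> $ i $ j = (if i = j then softmax \<psi> $ i else 0) - softmax \<psi> $ i * softmax \<psi> $ j"
proof -
  define \<pi> where "\<pi> = softmax \<psi>"
  have "softmax_fisher \<psi> $ i $ j =
      (\<Sum>a\<in>UNIV. \<pi> $ a * (((if i = a then 1 else 0) - \<pi> $ i) * ((if j = a then 1 else 0) - \<pi> $ j)))"
    by (simp add: softmax_fisher_def gradient_ln_softmax axis_def Let_def \<pi>_def sum_component eq_commute)
  also have "\<dots> = (\<Sum>a\<in>UNIV. (if i = a then if i = j then \<pi> $ i else 0 else 0)
      - (if j = a then \<pi> $ a * \<pi> $ i else 0) - (if i = a then \<pi> $ a * \<pi> $ j else 0)
      + \<pi> $ a * (\<pi> $ i * \<pi> $ j))"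
    by (rule sum.cong) (auto simp: algebra_simps)
  also have "\<dots> = (if i = j then \<pi> $ i else 0) - \<pi> $ i * \<pi> $ j"
    using sum_softmax[of \<psi>]
    by (simp add: sum.distrib sum_subtractf \<pi>_def flip: sum_distrib_right)
  finally show ?thesis
    by (simp add: \<pi>_def)
qed

lemma softmax_fisher_mult_vec:
  "(softmax_fisher \<psi> *v v) $ a = softmax \<psi> $ a * (v $ a - (\<Sum>b\<in>UNIV. softmax \<psi> $ b * v $ b))"
proof -
  have "(softmax_fisher \<psi> *v v) $ a =
      (\<Sum>b\<in>UNIV. (if a = b then softmax \<psi> $ a * v $ b else 0) - softmax \<psi> $ a * (softmax \<psi> $ b * v $ b))"
    unfolding matrix_vector_mult_def softmax_fisher_nth vec_lambda_beta
    by (rule sum.cong) (auto simp: algebra_simps)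
  then show ?thesis
    by (simp add: sum_subtractf right_diff_distrib flip: sum_distrib_left)
qed

lemma transpose_softmax_fisher: "transpose (softmax_fisher \<psi>) = softmax_fisher \<psi>"
  by (auto simp: transpose_def vec_eq_iff softmax_fisher_nth)

text \<open>
  For \<open>m \<ge> 0\<close>, the orthogonal projection onto the kernel of \<open>m *\<^sub>R softmax_fisher \<psi>\<close>.  The parameters of a softmax
  are determined up to a common constant, so for \<open>m > 0\<close> the kernel consists of the constant vectors
  and the projection takes the mean.
\<close>

definition kernel_projection :: "real \<Rightarrow> real ^ 'a ^ 'a::finite" where
  "kernel_projection m = (if 0 < m then (\<chi> i j. 1 / real CARD('a)) else mat 1)"

lemma kernel_projection_mult_vec:
  "(kernel_projection m *v v) $ a =
    (if 0 < m then 1 / real CARD('a) * (\<Sum>b\<in>UNIV. v $ b) else v $ a)" for v :: "real ^ 'a::finite"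
  by (simp add: kernel_projection_def matrix_vector_mult_def sum_divide_distrib mat_def
      if_distrib[of "\<lambda>x. x * _"] cong: if_cong)

lemma transpose_kernel_projection: "transpose (kernel_projection m) = kernel_projection m"
  by (simp add: kernel_projection_def transpose_def vec_eq_iff mat_def)

lemma kernel_projection_idem: "kernel_projection m ** kernel_projection m = kernel_projection m"
  by (subst matrix_eq)
    (simp add: vec_eq_iff kernel_projection_mult_vec flip: matrix_vector_mul_assoc)

lemma softmax_fisher_kernel_projection:
  assumes "0 \<le> m"
  shows "(m *\<^sub>R softmax_fisher \<psi>) ** kernel_projection m = 0"
  using assms sum_softmax[of \<psi>]
  by (subst matrix_eq)
    (auto simp: vec_eq_iff kernel_projection_mult_vec softmax_fisher_mult_vec
        scaleR_matrix_vector_assoc[symmetric]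
        simp flip: matrix_vector_mul_assoc sum_distrib_right sum_divide_distrib)

lemma softmax_fisher_kernel:
  assumes "(m *\<^sub>R softmax_fisher \<psi>) *v v = 0" and "kernel_projection m *v v = 0" and "0 \<le> m"
  shows "v = 0"
proof (cases "0 < m")
  case True
  define c where "c = (\<Sum>b\<in>UNIV. softmax \<psi> $ b * v $ b)"
  have v: "v $ a = c" for a
  proof -
    have "(softmax_fisher \<psi> *v v) $ a = 0"
      using assms(1) True by (simp add: scaleR_matrix_vector_assoc[symmetric])
    then show ?thesis
      using softmax_pos[of \<psi> a] by (simp add: softmax_fisher_mult_vec c_def)
  qed
  moreover have "(\<Sum>b\<in>UNIV. v $ b) = 0"
    using assms(2) True by (simp add: vec_eq_iff kernel_projection_mult_vec)
  ultimately show ?thesis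
    by (simp add: vec_eq_iff)
next
  case False
  with assms(2) show ?thesis
    by (simp add: kernel_projection_def)
qed

text \<open>
  A symmetric matrix composed with its pseudoinverse is the projection along its kernel: it subtracts
  the mean in blocks of positive mass and annihilates the others.
\<close>

lemma pinv_block_fisher:
  fixes q :: "real ^ ('t::finite \<times> 'z::finite \<times> 'a::finite)"
    and \<psi> :: "'t \<Rightarrow> 'z \<Rightarrow> real ^ 'a"
  assumes "\<And>n z. 0 \<le> m n z"
  defines "A \<equiv> block_diag (\<lambda>n z. m n z *\<^sub>R softmax_fisher (\<psi> n z))"
  shows "(pinv A *v (A *v q)) $ (n, z, a) =
    q $ (n, z, a) - (if 0 < m n z then 1 / real CARD('a) * (\<Sum>b\<in>UNIV. q $ (n, z, b)) else q $ (n, z, a))"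
proof -
  define K :: "real ^ ('t \<times> 'z \<times> 'a) ^ ('t \<times> 'z \<times> 'a)"
    where "K = block_diag (\<lambda>n z. kernel_projection (m n z))"
  have "pinv A *v (A *v q) = q - K *v q"
  proof (rule pinv_mult_self)
    show "transpose A = A"
      unfolding A_def transpose_block_diag transpose_scalar transpose_softmax_fisher ..
    show "transpose K = K"
      by (simp add: K_def transpose_block_diag transpose_kernel_projection)
    show "K ** K = K"
      by (simp add: K_def block_diag_mult kernel_projection_idem)
    show "A ** K = 0"
      using assms(1)
      by (simp add: A_def K_def block_diag_mult softmax_fisher_kernel_projection)
        (simp add: block_diag_def vec_eq_iff)
    show "v = 0" if "A *v v = 0" "K *v v = 0" for v
    proof -
      have "(\<chi> a. v $ (n, z, a)) = 0" for n z
      proof (rule softmax_fisher_kernel[OF _ _ assms(1)])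
        show "(m n z *\<^sub>R softmax_fisher (\<psi> n z)) *v (\<chi> a. v $ (n, z, a)) = 0"
          using that(1) by (simp add: A_def vec_eq_iff block_diag_mult_vec)
        show "kernel_projection (m n z) *v (\<chi> a. v $ (n, z, a)) = 0"
          using that(2) by (simp add: K_def vec_eq_iff block_diag_mult_vec)
      qed
      then show ?thesis
        by (simp add: vec_eq_iff)
    qed
  qed
  then show ?thesis
    by (simp add: K_def block_diag_mult_vec kernel_projection_mult_vec)
qed

section \<open>The approximate natural gradient\<close>

lemma cell_mass_nonneg:
  assumes "state_pmf M e g t \<in> pmfs"
  shows "0 \<le> cell_mass M e g t z"
  using assms by (simp add: cell_mass_def pmfs_def sum_nonneg)

lemma cell_mass_mult_Q_bar:
  assumes pmf: "state_pmf M e g t \<in> pmfs"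
  shows "cell_mass M e g t z * Q_bar M D e g t z a = (\<Sum>s\<in>cell e z. state_pmf M e g t $ s *
    Q_fun M t (state_pmf M e g t) (costate M D e g (Suc t)) s a)"
proof (cases "0 < cell_mass M e g t z")
  case True
  then show ?thesis
    by (simp add: Q_bar_def sum_distrib_left)
next
  case False
  with cell_mass_nonneg[OF pmf, of z] have "cell_mass M e g t z = 0"
    by simp
  then have "\<forall>s\<in>cell e z. state_pmf M e g t $ s = 0"
    using pmf by (simp add: cell_mass_def pmfs_def sum_nonneg_eq_0_iff)
  with False show ?thesis
    by (simp add: Q_bar_def)
qed

text \<open>
  The softmax Fisher matrix is also the derivative of the softmax, so the gradient of the objective
  is the approximate Fisher matrix applied to \<^const>\<open>Q_bar\<close>.
\<close>

lemma d_objective_fisher: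
  fixes M :: "('s::finite, 'a::finite) mdp" and e :: "'s \<Rightarrow> 'z::finite"
  assumes M: "nonlinear_mdp M"
  shows "d_objective M D e g h = (\<Sum>t<horizon M. \<Sum>z\<in>UNIV. \<Sum>a\<in>UNIV. h t z $ a *
    ((cell_mass M e g t z *\<^sub>R softmax_fisher (g t z)) *v (\<chi> b. Q_bar M D e g t z b)) $ a)"
  unfolding d_objective_eq
proof (rule sum.cong[OF refl])
  fix t assume "t \<in> {..<horizon M}"
  then have pmf: "state_pmf M e g t \<in> pmfs"
    by (intro state_pmf_in_pmfs[OF M]) auto
  define \<mu> Q where defs: "\<mu> = state_pmf M e g t"
    "Q = Q_fun M t (state_pmf M e g t) (costate M D e g (Suc t))"
  define \<pi> v where "\<pi> z = softmax (g t z)" and "v z = h t z" for z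
  define m q where "m z = cell_mass M e g t z" and "q z = (\<chi> b. Q_bar M D e g t z b)" for z
  note defs = defs \<pi>_def v_def m_def q_def
  have mq: "(\<Sum>s\<in>cell e z. \<mu> $ s * Q s a) = m z * q z $ a" for z a
    using cell_mass_mult_Q_bar[OF pmf, of z D a] by (simp add: defs)
  have covariance: "(\<Sum>a\<in>UNIV. p $ a * x $ a * (y $ a - (\<Sum>b\<in>UNIV. p $ b * y $ b))) =
      (\<Sum>a\<in>UNIV. p $ a * (x $ a * y $ a)) - (\<Sum>a\<in>UNIV. p $ a * x $ a) * (\<Sum>a\<in>UNIV. p $ a * y $ a)"
    for p x y :: "real ^ 'a"
    by (simp add: right_diff_distrib sum_subtractf sum_distrib_right mult.assoc)
  have "(\<Sum>s\<in>UNIV. \<Sum>a\<in>UNIV. \<mu> $ s * d_policy e g h t s a * Q s a) =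
      (\<Sum>z\<in>UNIV. \<Sum>s\<in>cell e z. \<Sum>a\<in>UNIV. \<mu> $ s * d_policy e g h t s a * Q s a)"
    using sum.group[of UNIV UNIV e "\<lambda>s. \<Sum>a\<in>UNIV. \<mu> $ s * d_policy e g h t s a * Q s a"]
    by (simp add: cell_def)
  also have "\<dots> = (\<Sum>z\<in>UNIV. \<Sum>a\<in>UNIV. \<Sum>s\<in>cell e z.
      \<pi> z $ a * (v z $ a - (\<Sum>b\<in>UNIV. \<pi> z $ b * v z $ b)) * (\<mu> $ s * Q s a))"
    by (rule sum.cong[OF refl], subst sum.swap, intro sum.cong refl)
      (simp add: d_policy_def policy_def defs cell_def)
  also have "\<dots> = (\<Sum>z\<in>UNIV. m z * (\<Sum>a\<in>UNIV.
      \<pi> z $ a * q z $ a * (v z $ a - (\<Sum>b\<in>UNIV. \<pi> z $ b * v z $ b))))"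
    by (simp add: mq sum_distrib_left[symmetric]) (simp add: sum_distrib_left mult_ac)
  \<comment> \<open>The covariance is symmetric, so the centring moves from the direction to the values.\<close>
  also have "\<dots> = (\<Sum>z\<in>UNIV. m z * (\<Sum>a\<in>UNIV.
      \<pi> z $ a * v z $ a * (q z $ a - (\<Sum>b\<in>UNIV. \<pi> z $ b * q z $ b))))"
    by (simp only: covariance mult.commute)
  also have "\<dots> = (\<Sum>z\<in>UNIV. \<Sum>a\<in>UNIV. v z $ a * ((m z *\<^sub>R softmax_fisher (g t z)) *v q z) $ a)"
    by (simp add: scaleR_matrix_vector_assoc[symmetric] softmax_fisher_mult_vec sum_distrib_left
        mult_ac flip: \<pi>_def)
  finally show "(\<Sum>s\<in>UNIV. \<Sum>a\<in>UNIV. state_pmf M e g t $ s * d_policy e g h t s a *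
        Q_fun M t (state_pmf M e g t) (costate M D e g (Suc t)) s a) =
      (\<Sum>z\<in>UNIV. \<Sum>a\<in>UNIV. h t z $ a *
        ((cell_mass M e g t z *\<^sub>R softmax_fisher (g t z)) *v (\<chi> b. Q_bar M D e g t z b)) $ a)"
    by (simp add: defs)
qed

theorem proposition4:
  fixes M :: "('s::finite, 'a::finite) mdp"
    and D :: "('s, 'a) mdp_gradients"
    and e :: "'s \<Rightarrow> 'z::finite"
    and \<iota> :: "nat \<Rightarrow> 't::finite"
    and \<gamma> :: "real ^ ('t \<times> 'z \<times> 'a)"
  assumes "nonlinear_mdp M"
    and "extension_gradients M D"
    and "bij_betw \<iota> {..<horizon M} UNIV"
    and "\<forall>t<horizon M. \<forall>z. (\<Sum>a\<in>UNIV. \<gamma> $ (\<iota> t, z, a)) = 0"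
    and "rewards_bounded_near M e \<iota> \<gamma>"
  shows "\<forall>t<horizon M. \<forall>z a.
    approx_natural_gradient M e \<iota> \<gamma> $ (\<iota> t, z, a) =
      Q_bar M D e (blocks \<iota> \<gamma>) t z a -
      1 / real CARD('a) * (\<Sum>b\<in>UNIV. Q_bar M D e (blocks \<iota> \<gamma>) t z b)"
proof (intro allI impI)
  fix t z a assume t: "t < horizon M"
  define g where "g = blocks \<iota> \<gamma>"
  define time where "time = inv_into {..<horizon M} \<iota>"
  have time: "time (\<iota> t) = t" if "t < horizon M" for t
    using assms(3) that by (simp add: time_def bij_betw_def inv_into_f_f)
  have time_less: "time n < horizon M" for n
    using inv_into_into[of n \<iota> "{..<horizon M}"] assms(3) by (simp add: time_def bij_betw_def)
  define m where "m n z = cell_mass M e g (time n) z" for n z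
  define \<psi> where "\<psi> n z = blocks \<iota> \<gamma> (time n) z" for n z
  define q :: "real ^ ('t \<times> 'z \<times> 'a)"
    where "q = (\<chi> i. case i of (n, z, a) \<Rightarrow> Q_bar M D e g (time n) z a)"
  define A :: "real ^ ('t \<times> 'z \<times> 'a) ^ ('t \<times> 'z \<times> 'a)"
    where "A = block_diag (\<lambda>n z. m n z *\<^sub>R softmax_fisher (\<psi> n z))"
  have A_eq: "approx_fisher M e \<iota> \<gamma> = A"
    by (auto simp: vec_eq_iff approx_fisher_def A_def block_diag_def m_def \<psi>_def g_def time_def Let_def)
  have "d_objective M D e g (blocks \<iota> h) = h \<bullet> (A *v q)" for h
  proof -
    define F where "F t z a = ((cell_mass M e g t z *\<^sub>R softmax_fisher (g t z)) *v
        (\<chi> b. Q_bar M D e g t z b)) $ a" for t z a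
    have "d_objective M D e g (blocks \<iota> h) =
        (\<Sum>t<horizon M. \<Sum>z\<in>UNIV. \<Sum>a\<in>UNIV. h $ (\<iota> t, z, a) * F (time (\<iota> t)) z a)"
      by (simp add: d_objective_fisher[OF assms(1)] time F_def) (simp add: blocks_def)
    also have "\<dots> = (\<Sum>n\<in>UNIV. \<Sum>z\<in>UNIV. \<Sum>a\<in>UNIV. h $ (n, z, a) * F (time n) z a)"
      by (rule sum.reindex_bij_betw[OF assms(3),
            of "\<lambda>n. \<Sum>z\<in>UNIV. \<Sum>a\<in>UNIV. h $ (n, z, a) * F (time n) z a"])
    also have "\<dots> = h \<bullet> (A *v q)"
      by (simp add: inner_vec_def sum_blocks F_def A_def block_diag_mult_vec m_def \<psi>_def g_def q_def)
    finally show ?thesis .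
  qed
  then have grad: "gradient (\<lambda>\<gamma>'. objective M e (blocks \<iota> \<gamma>')) \<gamma> = A *v q"
    using has_derivative_objective[OF assms(1,2,5)]
    by (intro gradient_eqI) (simp add: gderiv_def g_def)
  have "0 \<le> m n z" for n z
    unfolding m_def using time_less[of n] assms(1)
    by (intro cell_mass_nonneg state_pmf_in_pmfs) auto
  from pinv_block_fisher[OF this, where \<psi> = \<psi> and q = q and n = "\<iota> t" and z = z and a = a]
  have "approx_natural_gradient M e \<iota> \<gamma> $ (\<iota> t, z, a) = q $ (\<iota> t, z, a) -
      (if 0 < m (\<iota> t) z then 1 / real CARD('a) * (\<Sum>b\<in>UNIV. q $ (\<iota> t, z, b)) else q $ (\<iota> t, z, a))"
    by (simp add: approx_natural_gradient_def A_eq grad A_def)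
  also have "\<dots> = Q_bar M D e g t z a - 1 / real CARD('a) * (\<Sum>b\<in>UNIV. Q_bar M D e g t z b)"
    by (simp add: q_def time[OF t] m_def) (simp add: Q_bar_def)
  finally show "approx_natural_gradient M e \<iota> \<gamma> $ (\<iota> t, z, a) =
      Q_bar M D e (blocks \<iota> \<gamma>) t z a -
      1 / real CARD('a) * (\<Sum>b\<in>UNIV. Q_bar M D e (blocks \<iota> \<gamma>) t z b)"
    by (simp add: g_def)
qed

end
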